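(* Let $S$, $\geq$, $\mathcal{P}(S)$, $H$, $\mathcal{H}$, $Q$ be as in the context. Let $D \subseteq \mathbb{R}^{S}$ be a non-empty set such that $H$ is increasing with respect to $\succeq_{D}$. Assume that $Q$ is $D$-preserving and $D$-decreasing. Assume moreover that at least one of the following two conditions holds: (i) $Q$ satisfies Property (C) and $\succeq_{D}$ is closed with respect to weak convergence; (ii) $Q$ satisfies Property (U) and $(\mathcal{P}(S),\succeq_{D})$ is a complete lattice. Then $Q$ has at most one invariant distribution, i.e. the operator $T$ has at most one fixed point in $\mathcal{P}(S)$.
   Context: $S$ is a Polish space with Borel $\sigma$-algebra $\mathcal{B}(S)$, endowed with a closed partial order $\geq$. $\mathcal{P}(S)$ is the set of Borel probability measures on $S$ with the weak topology ($\mu_n\to\mu$ weakly iff $\int f\,d\mu_n\to\int f\,d\mu$ for all bounded continuous $f$). $H:\mathcal{P}(S)\to\mathbb{R}$ is a measurable function (the aggregator) and $\mathcal{H}=\{H(\mu):\mu\in\mathcal{P}(S)\}$. Let $E$ be a Polish space, $\phi$ a probability measure on $E$, and $w:S\times\mathcal{H}\times E\to S$ measurable; the nonlinear Markov kernel is $Q(x,h,B)=\phi(\{\epsilon\in E: w(x,h,\epsilon)\in B\})$ for $x\in S$, $h\in\mathcal{H}$, $B\in\mathcal{B}(S)$ (this describes the chain $X_{t+1}=w(X_t,H(\mu_t),\epsilon_{t+1})$ with $\mu_t$ the law of $X_t$ and $\epsilon_t$ i.i.d. with law $\phi$). Define $T:\mathcal{P}(S)\to\mathcal{P}(S)$ by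 $T\mu(B)=\int_S Q(x,H(\mu),B)\,\mu(dx)$; $\mu$ is an invariant distribution of $Q$ if $T\mu=\mu$. For $h\in\mathcal{H}$, define $M_h:\mathcal{P}(S)\to\mathcal{P}(S)$ by $M_h\theta(B)=\int_S Q(x,h,B)\,\theta(dx)$, and $M_h^n$ its $n$-fold iterate. Stochastic order: for $D\subseteq\mathbb{R}^S$ and $\mu_1,\mu_2\in\mathcal{P}(S)$, write $\mu_2\succeq_D\mu_1$ if $\int f\,d\mu_2\ge\int f\,d\mu_1$ for all Borel measurable $f\in D$ for which the integrals exist. $\succeq_D$ is closed with respect to weak convergence if $\mu^1_n\succeq_D\mu^2_n$ for all $n$, $\mu^1_n\to\mu^1$ and $\mu^2_n\to\mu^2$ weakly imply $\mu^1\succeq_D\mu^2$. $H$ is increasing with respect to $\succeq_D$ if $\mu_2\succeq_D\mu_1$ implies $H(\mu_2)\ge H(\mu_1)$. Property (U): for every $h\in\mathcal{H}$, $M_h$ has a unique fixed point $\mu_h$. Property (C): Property (U) holds and, for every $h\in\mathcal{H}$ and every $\theta\in\mathcal{P}(S)$, $M_h^n\theta$ converges weakly to $\mu_h$ as $n\to\infty$. $Q$ is $D$-decreasing if for each $x\in S$ and $h_1,h_2\in\mathcal{H}$ with $h_2\ge h_1$, $Q(x,h_1,\cdot)\succeq_D Q(x,h_2,\cdot)$. $Q$ is $D$-preserving if for every $h\in\mathcal{H}$ and every $f\in D$, the function $v(x)=\int_S f(y)\,Q(x,h,dy)$ belongs to $D$. *)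

theory Defs
  imports "HOL-Probability.Probability"
begin

definition PS :: "('a::topological_space) measure set" where
  "PS = space (prob_algebra (borel :: 'a measure))"

definition weak_conv :: "(nat \<Rightarrow> ('a::topological_space) measure) \<Rightarrow> 'a measure \<Rightarrow> bool" where
  "weak_conv \<mu>s \<mu> \<longleftrightarrow>
     (\<forall>f :: 'a \<Rightarrow> real. continuous_on UNIV f \<and> bounded (range f) \<longrightarrow>
        (\<lambda>n. integral\<^sup>L (\<mu>s n) f) \<longlonglongrightarrow> integral\<^sup>L \<mu> f)"

definition Qk :: "('a \<Rightarrow> real \<Rightarrow> 'e \<Rightarrow> 'a) \<Rightarrow> ('e::topological_space) measure \<Rightarrow> 'a \<Rightarrow> real
     \<Rightarrow> ('a::topological_space) measure" where
  "Qk w \<phi> x h = distr \<phi> borel (w x h)"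

definition Mh :: "('a \<Rightarrow> real \<Rightarrow> 'e \<Rightarrow> 'a) \<Rightarrow> ('e::topological_space) measure \<Rightarrow> real
     \<Rightarrow> ('a::topological_space) measure \<Rightarrow> 'a measure" where
  "Mh w \<phi> h \<theta> = measure_of UNIV (sets borel) (\<lambda>B. \<integral>\<^sup>+ x. emeasure (Qk w \<phi> x h) B \<partial>\<theta>)"

definition Top :: "('a measure \<Rightarrow> real) \<Rightarrow> ('a \<Rightarrow> real \<Rightarrow> 'e \<Rightarrow> 'a) \<Rightarrow> ('e::topological_space) measure
     \<Rightarrow> ('a::topological_space) measure \<Rightarrow> 'a measure" where
  "Top H w \<phi> \<mu> = measure_of UNIV (sets borel) (\<lambda>B. \<integral>\<^sup>+ x. emeasure (Qk w \<phi> x (H \<mu>)) B \<partial>\<mu>)"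

definition stoch_ge :: "(('a::topological_space) \<Rightarrow> real) set \<Rightarrow> 'a measure \<Rightarrow> 'a measure \<Rightarrow> bool" where
  "stoch_ge D \<mu>2 \<mu>1 \<longleftrightarrow>
     (\<forall>f\<in>D. f \<in> borel_measurable borel \<and> integrable \<mu>1 f \<and> integrable \<mu>2 f \<longrightarrow>
        integral\<^sup>L \<mu>2 f \<ge> integral\<^sup>L \<mu>1 f)"

definition stoch_closed :: "(('a::topological_space) \<Rightarrow> real) set \<Rightarrow> bool" where
  "stoch_closed D \<longleftrightarrow>
     (\<forall>\<mu>1s \<mu>2s \<mu>1 \<mu>2. (\<forall>n. \<mu>1s n \<in> PS \<and> \<mu>2s n \<in> PS) \<and> \<mu>1 \<in> PS \<and> \<mu>2 \<in> PS \<and>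
        (\<forall>n. stoch_ge D (\<mu>1s n) (\<mu>2s n)) \<and> weak_conv \<mu>1s \<mu>1 \<and> weak_conv \<mu>2s \<mu>2
        \<longrightarrow> stoch_ge D \<mu>1 \<mu>2)"

definition H_increasing :: "(('a::topological_space) \<Rightarrow> real) set \<Rightarrow> ('a measure \<Rightarrow> real) \<Rightarrow> bool" where
  "H_increasing D H \<longleftrightarrow> (\<forall>\<mu>1\<in>PS. \<forall>\<mu>2\<in>PS. stoch_ge D \<mu>2 \<mu>1 \<longrightarrow> H \<mu>2 \<ge> H \<mu>1)"

definition stoch_complete_lattice :: "(('a::topological_space) \<Rightarrow> real) set \<Rightarrow> bool" where
  "stoch_complete_lattice D \<longleftrightarrow>
     (\<forall>\<mu>\<in>PS. stoch_ge D \<mu> \<mu>) \<and>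
     (\<forall>\<mu>1\<in>PS. \<forall>\<mu>2\<in>PS. \<forall>\<mu>3\<in>PS. stoch_ge D \<mu>1 \<mu>2 \<and> stoch_ge D \<mu>2 \<mu>3 \<longrightarrow> stoch_ge D \<mu>1 \<mu>3) \<and>
     (\<forall>\<mu>1\<in>PS. \<forall>\<mu>2\<in>PS. stoch_ge D \<mu>1 \<mu>2 \<and> stoch_ge D \<mu>2 \<mu>1 \<longrightarrow> \<mu>1 = \<mu>2) \<and>
     (\<forall>A\<subseteq>PS. \<exists>s\<in>PS. (\<forall>\<mu>\<in>A. stoch_ge D s \<mu>) \<and>
                        (\<forall>u\<in>PS. (\<forall>\<mu>\<in>A. stoch_ge D u \<mu>) \<longrightarrow> stoch_ge D u s)) \<and>
     (\<forall>A\<subseteq>PS. \<exists>i\<in>PS. (\<forall>\<mu>\<in>A. stoch_ge D \<mu> i) \<and>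
                        (\<forall>l\<in>PS. (\<forall>\<mu>\<in>A. stoch_ge D \<mu> l) \<longrightarrow> stoch_ge D i l))"

definition propU :: "('a measure \<Rightarrow> real) \<Rightarrow> ('a \<Rightarrow> real \<Rightarrow> 'e \<Rightarrow> 'a) \<Rightarrow> ('e::topological_space) measure
     \<Rightarrow> ('a::topological_space) itself \<Rightarrow> bool" where
  "propU H w \<phi> _ \<longleftrightarrow> (\<forall>h\<in>H ` PS. \<exists>!\<mu>. \<mu> \<in> PS \<and> Mh w \<phi> h \<mu> = \<mu>)"

definition propC :: "('a measure \<Rightarrow> real) \<Rightarrow> ('a \<Rightarrow> real \<Rightarrow> 'e \<Rightarrow> 'a) \<Rightarrow> ('e::topological_space) measure
     \<Rightarrow> ('a::topological_space) itself \<Rightarrow> bool" where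
  "propC H w \<phi> t \<longleftrightarrow> propU H w \<phi> t \<and>
     (\<forall>h\<in>H ` PS. \<forall>\<mu>\<in>PS. Mh w \<phi> h \<mu> = \<mu> \<longrightarrow>
        (\<forall>\<theta>\<in>PS. weak_conv (\<lambda>n. (Mh w \<phi> h ^^ n) \<theta>) \<mu>))"

definition D_decreasing :: "(('a::topological_space) \<Rightarrow> real) set \<Rightarrow> ('a measure \<Rightarrow> real)
     \<Rightarrow> ('a \<Rightarrow> real \<Rightarrow> 'e \<Rightarrow> 'a) \<Rightarrow> ('e::topological_space) measure \<Rightarrow> bool" where
  "D_decreasing D H w \<phi> \<longleftrightarrow>
     (\<forall>x. \<forall>h1\<in>H ` PS. \<forall>h2\<in>H ` PS. h2 \<ge> h1 \<longrightarrow> stoch_ge D (Qk w \<phi> x h1) (Qk w \<phi> x h2))"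

definition D_preserving :: "(('a::topological_space) \<Rightarrow> real) set \<Rightarrow> ('a measure \<Rightarrow> real)
     \<Rightarrow> ('a \<Rightarrow> real \<Rightarrow> 'e \<Rightarrow> 'a) \<Rightarrow> ('e::topological_space) measure \<Rightarrow> bool" where
  "D_preserving D H w \<phi> \<longleftrightarrow>
     (\<forall>h\<in>H ` PS. \<forall>f\<in>D. (\<lambda>x. \<integral>y. f y \<partial>(Qk w \<phi> x h)) \<in> D)"

end

(*
  If mu1, mu2 are invariant and H mu1 <= H mu2, then mu_i is the fixed point of the linear kernel
  with h_i = H mu_i, and the kernel for h2 produces stochastically smaller laws than the one for h1.
  Hence mu1 dominates mu2, so H mu1 = H mu2, and uniqueness for this single h gives mu1 = mu2.
  The domination comes from iterating the h2 kernel on mu1 under (i), and from Tarski's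
  characterisation of the greatest fixed point under (ii).

  The members of D may be unbounded, so the order only tests functions integrable on both sides,
  and monotonicity of the kernels on laws may fail. Under (i) this is cured by mixing in a small
  multiple of a measure charging the whole orbit of mu1; under (ii) the least and greatest laws
  force every measurable member of D to be bounded.
*)
theory Submission
  imports Defs
begin

section \<open>Borel laws and integration against a composition of a law with a kernel\<close>

lemma PS_iff: "\<theta> \<in> PS \<longleftrightarrow> sets \<theta> = sets borel \<and> prob_space \<theta>"
  by (simp add: PS_def space_prob_algebra)

text \<open>Tonelli for \<open>\<bar>f\<bar>\<close> shows that the inner integrals of
  \<open>\<bar>f\<bar>\<close> are finite almost everywhere and have a finite outer integral, which
  gives the first two claims. The third holds for nonnegative functions by passing through
  nonnegative integrals, and for signed \<open>f\<close> by subtracting its two parts. At the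
  exceptional points the inner Bochner integral has the default value 0, which is harmless on a null
  set.\<close>

lemma
  fixes f :: "'b \<Rightarrow> real"
  assumes K[measurable]: "K \<in> M \<rightarrow>\<^sub>M subprob_algebra N" and ne: "space M \<noteq> {}"
    and f[measurable]: "f \<in> borel_measurable N" and int: "integrable (M \<bind> K) f"
  shows AE_integrable_of_bind: "AE x in M. integrable (K x) f"
    and integrable_integral_of_bind: "integrable M (\<lambda>x. \<integral>y. f y \<partial>K x)"
    and integral_bind_iterated: "integral\<^sup>L (M \<bind> K) f = (\<integral>x. \<integral>y. f y \<partial>K x \<partial>M)"
proof -
  have [measurable]: "(\<lambda>x. integral\<^sup>L (K x) g) \<in> borel_measurable M"
    if "g \<in> borel_measurable N" for g :: "'b \<Rightarrow> real"
    by (rule measurable_compose[OF K integral_measurable_subprob_algebra[OF that]])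
  have [measurable]: "(\<lambda>x. integral\<^sup>N (K x) g) \<in> borel_measurable M"
    if "g \<in> borel_measurable N" for g :: "'b \<Rightarrow> ennreal"
    by (rule measurable_compose[OF K nn_integral_measurable_subprob_algebra[OF that]])
  have sets_K: "sets (K x) = sets N" if "x \<in> space M" for x
    using K that by (rule sets_kernel)
  have meas_K: "g \<in> borel_measurable (K x)" if "x \<in> space M" "g \<in> borel_measurable N" for x and g :: "'b \<Rightarrow> real"
    using that(2) by (simp add: measurable_cong_sets[OF sets_K[OF that(1)] refl])
  have ae: "AE x in M. integrable (K x) g"
    if g[measurable]: "g \<in> borel_measurable N" and "integrable (M \<bind> K) g" for g :: "'b \<Rightarrow> real"
  proof -
    have "(\<integral>\<^sup>+x. \<integral>\<^sup>+y. ennreal (norm (g y)) \<partial>K x \<partial>M) = (\<integral>\<^sup>+y. ennreal (norm (g y)) \<partial>(M \<bind> K))"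
      by (rule nn_integral_bind[symmetric, OF _ K]) measurable
    also have "\<dots> < \<infinity>"
      using that(2) by (simp add: integrable_iff_bounded)
    finally have "AE x in M. (\<integral>\<^sup>+y. ennreal (norm (g y)) \<partial>K x) \<noteq> \<infinity>"
      by (intro nn_integral_PInf_AE) auto
    then show ?thesis
      using AE_space by eventually_elim (auto simp: integrable_iff_bounded less_top meas_K)
  qed
  have int_integral: "integrable M (\<lambda>x. \<integral>y. g y \<partial>K x)"
    if g[measurable]: "g \<in> borel_measurable N" and "integrable (M \<bind> K) g" for g :: "'b \<Rightarrow> real"
  proof (rule integrableI_bounded)
    have "(\<integral>\<^sup>+x. ennreal (norm (\<integral>y. g y \<partial>K x)) \<partial>M) \<le> (\<integral>\<^sup>+x. \<integral>\<^sup>+y. ennreal (norm (g y)) \<partial>K x \<partial>M)"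
    proof (rule nn_integral_mono_AE)
      show "AE x in M. ennreal (norm (\<integral>y. g y \<partial>K x)) \<le> (\<integral>\<^sup>+y. ennreal (norm (g y)) \<partial>K x)"
        using ae[OF that] by eventually_elim (rule integral_norm_bound_ennreal)
    qed
    also have "\<dots> = (\<integral>\<^sup>+y. ennreal (norm (g y)) \<partial>(M \<bind> K))"
      by (rule nn_integral_bind[symmetric, OF _ K]) measurable
    also have "\<dots> < \<infinity>"
      using that(2) by (simp add: integrable_iff_bounded)
    finally show "(\<integral>\<^sup>+x. ennreal (norm (\<integral>y. g y \<partial>K x)) \<partial>M) < \<infinity>" .
  qed measurable
  have nonneg: "integral\<^sup>L (M \<bind> K) g = (\<integral>x. \<integral>y. g y \<partial>K x \<partial>M)"
    if g[measurable]: "g \<in> borel_measurable N" and "integrable (M \<bind> K) g" and pos: "\<And>y. 0 \<le> g y"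
    for g :: "'b \<Rightarrow> real"
  proof -
    have "integral\<^sup>L (M \<bind> K) g = enn2real (\<integral>\<^sup>+y. ennreal (g y) \<partial>(M \<bind> K))"
      by (rule integral_eq_nn_integral) (use that in auto)
    also have "(\<integral>\<^sup>+y. ennreal (g y) \<partial>(M \<bind> K)) = (\<integral>\<^sup>+x. \<integral>\<^sup>+y. ennreal (g y) \<partial>K x \<partial>M)"
      by (rule nn_integral_bind[OF _ K]) measurable
    also have "\<dots> = (\<integral>\<^sup>+x. ennreal (\<integral>y. g y \<partial>K x) \<partial>M)"
    proof (rule nn_integral_cong_AE)
      show "AE x in M. (\<integral>\<^sup>+y. ennreal (g y) \<partial>K x) = ennreal (\<integral>y. g y \<partial>K x)"
        using ae[OF that(1,2)] by eventually_elim (simp add: nn_integral_eq_integral pos)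
    qed
    also have "enn2real \<dots> = (\<integral>x. \<integral>y. g y \<partial>K x \<partial>M)"
      by (rule integral_eq_nn_integral[symmetric]) (auto simp: pos)
    finally show ?thesis .
  qed
  define p n where "p = (\<lambda>y. max (f y) 0)" and "n = (\<lambda>y. max (- f y) 0)"
  have f_eq: "f y = p y - n y" for y
    by (simp add: p_def n_def max_def)
  have [measurable]: "p \<in> borel_measurable N" "n \<in> borel_measurable N"
    by (simp_all add: p_def n_def)
  have ip: "integrable (M \<bind> K) p" and "in": "integrable (M \<bind> K) n"
    using int by (simp_all add: p_def n_def integrable_max)
  have "integral\<^sup>L (M \<bind> K) f = integral\<^sup>L (M \<bind> K) p - integral\<^sup>L (M \<bind> K) n"
    unfolding f_eq by (rule Bochner_Integration.integral_diff[OF ip "in"])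
  also have "\<dots> = (\<integral>x. \<integral>y. p y \<partial>K x \<partial>M) - (\<integral>x. \<integral>y. n y \<partial>K x \<partial>M)"
    using nonneg[OF _ ip] nonneg[OF _ "in"] by (simp add: p_def n_def)
  also have "\<dots> = (\<integral>x. (\<integral>y. p y \<partial>K x) - (\<integral>y. n y \<partial>K x) \<partial>M)"
    using ip "in" by (intro Bochner_Integration.integral_diff[symmetric] int_integral) auto
  \<comment> \<open>Linearity of the inner integral is available only where both parts are
    integrable against \<open>K x\<close>, so the integrands agree merely almost everywhere.\<close>
  also have "\<dots> = (\<integral>x. \<integral>y. f y \<partial>K x \<partial>M)"
  proof (rule integral_cong_AE)
    show "AE x in M. (\<integral>y. p y \<partial>K x) - (\<integral>y. n y \<partial>K x) = (\<integral>y. f y \<partial>K x)"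
      using ae[OF _ ip] ae[OF _ "in"] unfolding f_eq by auto
  qed measurable
  finally show "integral\<^sup>L (M \<bind> K) f = (\<integral>x. \<integral>y. f y \<partial>K x \<partial>M)" .
  show "AE x in M. integrable (K x) f" "integrable M (\<lambda>x. \<integral>y. f y \<partial>K x)"
    using ae[OF f int] int_integral[OF f int] by simp_all
qed

lemma measurable_on_PS: "\<theta> \<in> PS \<Longrightarrow> measurable \<theta> N = measurable borel N"
  by (intro measurable_cong_sets) (auto simp: PS_iff)

lemma space_PS_ne: "\<theta> \<in> PS \<Longrightarrow> space \<theta> \<noteq> {}"
  by (simp add: PS_iff prob_space.not_empty)

lemma bind_PS:
  assumes "\<theta> \<in> PS" "K \<in> borel \<rightarrow>\<^sub>M prob_algebra borel"
  shows "\<theta> \<bind> K \<in> PS"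
  using prob_space_bind'[of \<theta> borel K borel] sets_bind'[of \<theta> borel K borel] assms
  by (simp add: PS_def space_prob_algebra)

lemma kernel_PS: "K \<in> borel \<rightarrow>\<^sub>M prob_algebra borel \<Longrightarrow> K x \<in> PS"
  unfolding PS_def by (rule measurable_space[of K borel]) auto

lemma
  fixes f :: "'a::topological_space \<Rightarrow> real"
  assumes \<theta>: "\<theta> \<in> PS" and K: "K \<in> borel \<rightarrow>\<^sub>M prob_algebra borel"
    and f: "f \<in> borel_measurable borel" and int: "integrable (\<theta> \<bind> K) f"
  shows AE_integrable_kernel: "AE x in \<theta>. integrable (K x) f"
    and integrable_integral_kernel: "integrable \<theta> (\<lambda>x. \<integral>y. f y \<partial>K x)"
    and integral_bind_kernel: "integral\<^sup>L (\<theta> \<bind> K) f = (\<integral>x. \<integral>y. f y \<partial>K x \<partial>\<theta>)"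
proof -
  have K': "K \<in> \<theta> \<rightarrow>\<^sub>M subprob_algebra borel"
    using measurable_prob_algebraD[OF K] by (simp add: measurable_on_PS[OF \<theta>])
  show "AE x in \<theta>. integrable (K x) f" "integrable \<theta> (\<lambda>x. \<integral>y. f y \<partial>K x)"
    "integral\<^sup>L (\<theta> \<bind> K) f = (\<integral>x. \<integral>y. f y \<partial>K x \<partial>\<theta>)"
    using AE_integrable_of_bind[OF K' space_PS_ne[OF \<theta>] f int]
      integrable_integral_of_bind[OF K' space_PS_ne[OF \<theta>] f int]
      integral_bind_iterated[OF K' space_PS_ne[OF \<theta>] f int] by simp_all
qed

lemma measurable_integral_kernel:
  fixes f :: "'a::topological_space \<Rightarrow> real"
  assumes "K \<in> borel \<rightarrow>\<^sub>M prob_algebra borel" "f \<in> borel_measurable borel"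
  shows "(\<lambda>x. \<integral>y. f y \<partial>K x) \<in> borel_measurable borel"
  by (rule measurable_compose[OF measurable_prob_algebraD[OF assms(1)] integral_measurable_subprob_algebra[OF assms(2)]])

section \<open>Countable mixtures of laws\<close>

text \<open>A \<open>pmf\<close> lives on a discrete space, so every family of laws is a kernel on
  it, and "almost every index" means every index in the support. Hence integrability against the
  mixture passes to each component of positive weight.\<close>

lemma
  fixes f :: "'a::topological_space \<Rightarrow> real"
  assumes \<theta>: "\<And>i. \<theta> i \<in> PS"
    and f: "f \<in> borel_measurable borel" and int: "integrable (measure_pmf p \<bind> \<theta>) f"
  shows integrable_mixture_component: "i \<in> set_pmf p \<Longrightarrow> integrable (\<theta> i) f"
    and integral_mixture: "integral\<^sup>L (measure_pmf p \<bind> \<theta>) f = (\<integral>i. integral\<^sup>L (\<theta> i) f \<partial>measure_pmf p)"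
proof -
  have "\<theta> \<in> measure_pmf p \<rightarrow>\<^sub>M prob_algebra borel"
    using \<theta> by (auto simp: PS_def)
  then have K: "\<theta> \<in> measure_pmf p \<rightarrow>\<^sub>M subprob_algebra borel"
    by (rule measurable_prob_algebraD)
  show "integral\<^sup>L (measure_pmf p \<bind> \<theta>) f = (\<integral>i. integral\<^sup>L (\<theta> i) f \<partial>measure_pmf p)"
    by (rule integral_bind_iterated[OF K _ f int]) simp
  show "integrable (\<theta> i) f" if "i \<in> set_pmf p"
    using AE_integrable_of_bind[OF K _ f int] that by (simp add: AE_measure_pmf_iff)
qed

lemma mixture_PS:
  assumes "\<And>i. \<theta> i \<in> PS"
  shows "measure_pmf p \<bind> \<theta> \<in> PS"
proof -
  have "\<theta> \<in> measure_pmf p \<rightarrow>\<^sub>M prob_algebra borel"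
    using assms by (auto simp: PS_def)
  moreover have "measure_pmf p \<in> space (prob_algebra (measure_pmf p))"
    by (simp add: space_prob_algebra measure_pmf.prob_space_axioms)
  ultimately show ?thesis
    using prob_space_bind'[of "measure_pmf p" "measure_pmf p" \<theta> borel]
      sets_bind'[of "measure_pmf p" "measure_pmf p" \<theta> borel]
    by (simp add: PS_iff)
qed

lemma integrable_bounded_PS:
  fixes f :: "'a::topological_space \<Rightarrow> real"
  assumes \<theta>: "\<theta> \<in> PS" and "f \<in> borel_measurable borel" "bounded (range f)"
  shows "integrable \<theta> f"
proof -
  interpret prob_space \<theta> using \<theta> by (simp add: PS_iff)
  obtain B where "\<And>x. norm (f x) \<le> B"
    using assms(3) by (auto simp: bounded_iff)
  then show ?thesis
    using assms(2) by (intro integrable_const_bound[where B=B]) (auto simp: measurable_on_PS[OF \<theta>])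
qed

text \<open>The convex combination with weight \<open>\<epsilon>\<close> on \<open>\<nu>\<close>,
  for \<open>\<epsilon>\<close> in the unit interval. Writing it as a Bernoulli mixture makes the
  facts on general mixtures apply.\<close>

definition mix2 :: "real \<Rightarrow> 'a measure \<Rightarrow> 'a measure \<Rightarrow> 'a measure" where
  "mix2 \<epsilon> \<nu> \<theta> = measure_pmf (bernoulli_pmf \<epsilon>) \<bind> (\<lambda>b. if b then \<nu> else \<theta>)"

lemma mix2_PS: "\<nu> \<in> PS \<Longrightarrow> \<theta> \<in> PS \<Longrightarrow> mix2 \<epsilon> \<nu> \<theta> \<in> PS"
  unfolding mix2_def by (rule mixture_PS) auto

lemma
  fixes f :: "'a::topological_space \<Rightarrow> real"
  assumes "\<nu> \<in> PS" "\<theta> \<in> PS" "0 < \<epsilon>" "\<epsilon> < 1" "f \<in> borel_measurable borel" "integrable (mix2 \<epsilon> \<nu> \<theta>) f"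
  shows integrable_mix2D: "integrable \<nu> f" "integrable \<theta> f"
    and integral_mix2: "integral\<^sup>L (mix2 \<epsilon> \<nu> \<theta>) f = \<epsilon> * integral\<^sup>L \<nu> f + (1 - \<epsilon>) * integral\<^sup>L \<theta> f"
proof -
  define c where "c = (\<lambda>b. if b then \<nu> else \<theta>)"
  have c: "c b \<in> PS" for b using assms by (simp add: c_def)
  have int: "integrable (measure_pmf (bernoulli_pmf \<epsilon>) \<bind> c) f"
    using assms(6) by (simp add: mix2_def c_def)
  show "integrable \<nu> f" "integrable \<theta> f"
    using integrable_mixture_component[OF c assms(5) int, of True]
      integrable_mixture_component[OF c assms(5) int, of False] assms(3,4)
    by (simp_all add: c_def)
  show "integral\<^sup>L (mix2 \<epsilon> \<nu> \<theta>) f = \<epsilon> * integral\<^sup>L \<nu> f + (1 - \<epsilon>) * integral\<^sup>L \<theta> f"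
    using integral_mixture[OF c assms(5) int] assms(3,4) by (simp add: c_def mix2_def)
qed

lemma weak_conv_mix2:
  assumes "\<nu> \<in> PS" "\<And>n. \<theta>s n \<in> PS" and lim: "weak_conv \<theta>s \<theta>"
    and "\<And>n. 0 < e n" "\<And>n. e n < 1" and e: "e \<longlonglongrightarrow> 0"
  shows "weak_conv (\<lambda>n. mix2 (e n) \<nu> (\<theta>s n)) \<theta>"
  unfolding weak_conv_def
proof (intro allI impI, elim conjE)
  fix f :: "'a \<Rightarrow> real"
  assume f: "continuous_on UNIV f" "bounded (range f)"
  then have meas: "f \<in> borel_measurable borel"
    by (simp add: borel_measurable_continuous_onI)
  have "integral\<^sup>L (mix2 (e n) \<nu> (\<theta>s n)) f = e n * integral\<^sup>L \<nu> f + (1 - e n) * integral\<^sup>L (\<theta>s n) f" for n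
    using assms meas f by (intro integral_mix2 integrable_bounded_PS mix2_PS) auto
  moreover have "(\<lambda>n. e n * integral\<^sup>L \<nu> f + (1 - e n) * integral\<^sup>L (\<theta>s n) f)
      \<longlonglongrightarrow> 0 * integral\<^sup>L \<nu> f + (1 - 0) * integral\<^sup>L \<theta> f"
    using lim f unfolding weak_conv_def by (intro tendsto_intros e) auto
  ultimately show "(\<lambda>n. integral\<^sup>L (mix2 (e n) \<nu> (\<theta>s n)) f) \<longlonglongrightarrow> integral\<^sup>L \<theta> f"
    by simp
qed

section \<open>Comparison along the iterates of a kernel, for condition (i)\<close>

lemma iterates_PS:
  fixes K :: "'a::topological_space \<Rightarrow> 'a measure"
  assumes "K \<in> borel \<rightarrow>\<^sub>M prob_algebra borel" "\<theta> \<in> PS"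
  shows "((\<lambda>\<theta>. \<theta> \<bind> K) ^^ n) \<theta> \<in> PS"
proof (induction n)
  case (Suc n)
  then show ?case using bind_PS[OF Suc assms(1)] by simp
qed (use assms in simp)

text \<open>Induction on \<open>n\<close> with \<open>f\<close> varying: one application of
  \<open>K2\<close> is moved from the law to the test function, which stays in \<open>D\<close>. The
  induction hypothesis for the new function leaves a single step from \<open>\<mu>\<close>, where
  \<open>K2\<close> lies below \<open>K1\<close> and \<open>\<mu>\<close> is invariant under
  \<open>K1\<close>. Integrability is demanded along the whole orbit because the new function
  inherits exactly this property.\<close>

lemma integral_iterates_le:
  fixes f :: "'a::topological_space \<Rightarrow> real"
  assumes K1: "K1 \<in> borel \<rightarrow>\<^sub>M prob_algebra borel" and K2: "K2 \<in> borel \<rightarrow>\<^sub>M prob_algebra borel"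
    and pres: "\<And>f. f \<in> D \<Longrightarrow> (\<lambda>x. \<integral>y. f y \<partial>K2 x) \<in> D"
    and decr: "\<And>x. stoch_ge D (K1 x) (K2 x)"
    and \<mu>: "\<mu> \<in> PS" "\<mu> \<bind> K1 = \<mu>"
    and "f \<in> D" "f \<in> borel_measurable borel"
    and "\<And>n. integrable (((\<lambda>\<theta>. \<theta> \<bind> K2) ^^ n) \<mu>) f"
  shows "integral\<^sup>L (((\<lambda>\<theta>. \<theta> \<bind> K2) ^^ n) \<mu>) f \<le> integral\<^sup>L \<mu> f"
  using assms(7-)
proof (induction n arbitrary: f)
  case (Suc n)
  let ?I = "\<lambda>n. ((\<lambda>\<theta>. \<theta> \<bind> K2) ^^ n) \<mu>"
  let ?v = "\<lambda>x. \<integral>y. f y \<partial>K2 x"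
  have int: "integrable (?I k \<bind> K2) f" for k
    using Suc.prems(3)[of "Suc k"] by simp
  have int1: "integrable (\<mu> \<bind> K1) f"
    using Suc.prems(3)[of 0] \<mu> by simp
  have v: "integrable (?I k) ?v" for k
    by (rule integrable_integral_kernel[OF iterates_PS[OF K2 \<mu>(1)] K2 Suc.prems(2) int])
  have "integral\<^sup>L (?I (Suc n)) f = integral\<^sup>L (?I n) ?v"
    using integral_bind_kernel[OF iterates_PS[OF K2 \<mu>(1)] K2 Suc.prems(2) int] by simp
  also have "\<dots> \<le> integral\<^sup>L \<mu> ?v"
    by (rule Suc.IH[OF pres[OF Suc.prems(1)] measurable_integral_kernel[OF K2 Suc.prems(2)] v])
  also have "\<dots> \<le> (\<integral>x. \<integral>y. f y \<partial>K1 x \<partial>\<mu>)"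
  proof (rule integral_mono_AE)
    show "integrable \<mu> ?v" using v[of 0] by simp
    show "integrable \<mu> (\<lambda>x. \<integral>y. f y \<partial>K1 x)"
      by (rule integrable_integral_kernel[OF \<mu>(1) K1 Suc.prems(2) int1])
    \<comment> \<open>\<open>decr\<close> tests \<open>f\<close> only at points where it is
      integrable against both kernels. Almost every point is of this kind, since \<open>f\<close> is
      integrable against \<open>\<mu> \<bind> K2\<close> and
      \<open>\<mu> \<bind> K1\<close>.\<close>
    have "AE x in \<mu>. integrable (K2 x) f"
      using int[of 0] by (intro AE_integrable_kernel[OF \<mu>(1) K2 Suc.prems(2)]) simp
    then show "AE x in \<mu>. ?v x \<le> (\<integral>y. f y \<partial>K1 x)"
      using AE_integrable_kernel[OF \<mu>(1) K1 Suc.prems(2) int1]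
      by eventually_elim (use decr Suc.prems in \<open>auto simp: stoch_ge_def\<close>)
  qed
  also have "\<dots> = integral\<^sup>L \<mu> f"
    using integral_bind_kernel[OF \<mu>(1) K1 Suc.prems(2) int1] \<mu> by simp
  finally show ?case .
qed simp

text \<open>A comparison of \<^term>\<open>\<mu>\<close> with its iterates may fail for functions that are integrable at the
  two endpoints but not along the orbit. Mixing in a vanishing weight of \<^term>\<open>\<nu>\<close>, which charges the
  whole orbit, removes exactly those functions from the comparison.\<close>
lemma stoch_ge_limit_iterates:
  fixes \<mu> :: "'a::topological_space measure"
  assumes K1: "K1 \<in> borel \<rightarrow>\<^sub>M prob_algebra borel" and K2: "K2 \<in> borel \<rightarrow>\<^sub>M prob_algebra borel"
    and pres: "\<And>f. f \<in> D \<Longrightarrow> (\<lambda>x. \<integral>y. f y \<partial>K2 x) \<in> D"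
    and decr: "\<And>x. stoch_ge D (K1 x) (K2 x)"
    and \<mu>: "\<mu> \<in> PS" "\<mu> \<bind> K1 = \<mu>" and \<mu>': "\<mu>' \<in> PS"
    and lim: "weak_conv (\<lambda>n. ((\<lambda>\<theta>. \<theta> \<bind> K2) ^^ n) \<mu>) \<mu>'"
    and closed: "stoch_closed D"
  shows "stoch_ge D \<mu> \<mu>'"
proof -
  define I where "I n = ((\<lambda>\<theta>. \<theta> \<bind> K2) ^^ n) \<mu>" for n
  \<comment> \<open>The geometric weights are positive at every index, so a function integrable
    against \<open>\<nu>\<close> is integrable against every iterate.\<close>
  define \<nu> where "\<nu> = measure_pmf (geometric_pmf (1/2)) \<bind> I"
  \<comment> \<open>The shift by 2 keeps the weight strictly between 0 and 1 even at
    \<open>n = 0\<close>, so that both components of \<open>mix2\<close> are present.\<close>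
  define e where "e n = 1 / real (n + 2)" for n
  have I: "I n \<in> PS" for n
    unfolding I_def by (rule iterates_PS[OF K2 \<mu>(1)])
  have \<nu>: "\<nu> \<in> PS"
    unfolding \<nu>_def by (rule mixture_PS[OF I])
  have e: "0 < e n" "e n < 1" for n
    by (simp_all add: e_def)
  have e_lim: "e \<longlonglongrightarrow> 0"
    unfolding e_def using LIMSEQ_ignore_initial_segment[OF lim_1_over_n, of 2] by simp
  have "stoch_ge D (mix2 (e n) \<nu> \<mu>) (mix2 (e n) \<nu> (I n))" for n
    unfolding stoch_ge_def
  proof (intro ballI impI, elim conjE)
    fix f assume f: "f \<in> D" "f \<in> borel_measurable borel"
      and int: "integrable (mix2 (e n) \<nu> (I n)) f" "integrable (mix2 (e n) \<nu> \<mu>) f"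
    have "integrable \<nu> f"
      by (rule integrable_mix2D(1)[OF \<nu> \<mu>(1) e f(2) int(2)])
    then have "integrable (I k) f" for k
      unfolding \<nu>_def by (rule integrable_mixture_component[OF I f(2)]) (simp add: set_pmf_geometric)
    then have "integral\<^sup>L (I n) f \<le> integral\<^sup>L \<mu> f"
      unfolding I_def by (intro integral_iterates_le[OF K1 K2 pres decr \<mu> f])
    \<comment> \<open>Both mixtures have the same \<open>\<nu>\<close> term, so only the comparison
      of \<open>I n\<close> with \<open>\<mu>\<close> remains, scaled by
      \<open>1 - e n\<close>.\<close>
    then show "integral\<^sup>L (mix2 (e n) \<nu> (I n)) f \<le> integral\<^sup>L (mix2 (e n) \<nu> \<mu>) f"
      using integral_mix2[OF \<nu> I e f(2) int(1)] integral_mix2[OF \<nu> \<mu>(1) e f(2) int(2)] e[of n]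
      by (simp add: mult_left_mono)
  qed
  moreover have "weak_conv (\<lambda>n. mix2 (e n) \<nu> \<mu>) \<mu>"
    by (rule weak_conv_mix2) (auto simp: \<nu> \<mu> e e_lim weak_conv_def)
  moreover have "weak_conv (\<lambda>n. mix2 (e n) \<nu> (I n)) \<mu>'"
    by (rule weak_conv_mix2) (use lim in \<open>auto simp: \<nu> I e e_lim simp flip: I_def\<close>)
  ultimately show ?thesis
    using closed[unfolded stoch_closed_def, rule_format,
        of "\<lambda>n. mix2 (e n) \<nu> \<mu>" "\<lambda>n. mix2 (e n) \<nu> (I n)" \<mu> \<mu>']
    by (simp add: \<nu> \<mu>(1) \<mu>' I mix2_PS)
qed

section \<open>Boundedness of the test functions in a complete lattice of laws\<close>

text \<open>Conditioning a least element on an event leaves it minimal, so by antisymmetry it is unchanged: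
  the least element is a 0-1 measure, against which every measurable function is integrable.\<close>
lemma bdd_below_if_least:
  fixes b :: "'a::polish_space measure"
  assumes b: "b \<in> PS" and least: "\<And>\<mu>. \<mu> \<in> PS \<Longrightarrow> stoch_ge D \<mu> b"
    and antisym: "\<And>\<mu>. \<mu> \<in> PS \<Longrightarrow> stoch_ge D b \<mu> \<Longrightarrow> \<mu> = b"
    and f: "f \<in> D" "f \<in> borel_measurable borel"
  shows "\<exists>c. \<forall>x. c \<le> f x"
proof -
  interpret b: prob_space b using b by (simp add: PS_iff)
  have [simp, measurable_cong]: "sets b = sets borel" using b by (simp add: PS_iff)
  have space_b[simp]: "space b = UNIV" using sets_eq_imp_space_eq[of b borel] by simp
  note f(2)[measurable]
  \<comment> \<open>Point masses are laws above \<open>b\<close>, and every measurable function is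
    integrable against them.\<close>
  have ge_b: "integral\<^sup>L b g \<le> g x" if "g \<in> D" "g \<in> borel_measurable borel" "integrable b g" for g x
  proof -
    have "return borel x \<in> PS" by (simp add: PS_iff prob_space_return)
    moreover have "integrable (return borel x) g"
      using that(2) by (auto simp: integrable_iff_bounded nn_integral_return)
    moreover have "integral\<^sup>L (return borel x) g = g x"
      using that(2) by (simp add: integral_return)
    ultimately show ?thesis
      using least[of "return borel x"] that by (force simp: stoch_ge_def)
  qed
  \<comment> \<open>The sets \<open>A n\<close> exhaust the space, so one of them has positive mass.
    Conditioning on it makes \<open>f\<close> bounded almost everywhere.\<close>
  define A where "A n = {x. \<bar>f x\<bar> \<le> real n}" for n :: nat
  have A[measurable]: "A n \<in> sets borel" for n
    unfolding A_def by measurable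
  obtain n where n: "emeasure b (A n) \<noteq> 0"
  proof (rule ccontr)
    assume "\<not> thesis"
    then have "emeasure b (A n) = 0" for n using that by blast
    then have "AE x in b. \<forall>n. x \<notin> A n"
      unfolding AE_all_countable by (intro allI AE_not_in) (auto simp: null_sets_def)
    moreover have "\<exists>n. x \<in> A n" for x
      by (simp add: A_def real_arch_simple)
    ultimately have "AE x in b. False" using AE_mp by fastforce
    then show False by simp
  qed
  define b' where "b' = uniform_measure b (A n)"
  have "prob_space b'"
    unfolding b'_def by (rule prob_space_uniform_measure) (use n in auto)
  then have b': "b' \<in> PS"
    by (simp add: PS_iff b'_def)
  have "stoch_ge D b b'"
    unfolding stoch_ge_def
  proof (intro ballI impI, elim conjE)
    fix g assume g: "g \<in> D" and [measurable]: "g \<in> borel_measurable borel"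
      and int: "integrable b' g" "integrable b g"
    let ?c = "integral\<^sup>L b g"
    \<comment> \<open>By \<open>ge_b\<close> the function \<open>g\<close> is nowhere below its mean
      under \<open>b\<close>, so it equals this mean almost surely, and conditioning does not change
      its integral.\<close>
    have "integral\<^sup>L b (\<lambda>x. g x - ?c) = 0"
      using int b.prob_space by simp
    then have "AE x in b. g x - ?c = 0"
      using int ge_b[OF g] by (subst (asm) integral_nonneg_eq_0_iff_AE) auto
    then have "AE x in b'. g x = ?c"
      unfolding b'_def by (intro AE_uniform_measureI) auto
    then have "integral\<^sup>L b' g = integral\<^sup>L b' (\<lambda>x. ?c)"
      by (intro integral_cong_AE) (auto simp: measurable_on_PS[OF b'])
    then show "integral\<^sup>L b' g \<le> ?c"
      using prob_space.prob_space[OF \<open>prob_space b'\<close>] by simp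
  qed
  then have "b' = b" by (rule antisym[OF b'])
  moreover have "AE x in b'. \<bar>f x\<bar> \<le> real n"
    unfolding b'_def by (rule AE_uniform_measureI) (auto simp: A_def)
  ultimately have "integrable b f"
    by (intro b.integrable_const_bound[where B="real n"]) auto
  then show ?thesis using ge_b[OF f] by blast
qed

text \<open>Negating the test functions reverses the order, so a greatest law for \<open>D\<close>
  is a least law for the negated set.\<close>

lemma stoch_ge_uminus: "stoch_ge ((\<lambda>f x. - f x) ` D) \<mu> \<nu> \<longleftrightarrow> stoch_ge D \<nu> \<mu>"
  by (auto simp: stoch_ge_def)

lemma
  assumes L: "stoch_complete_lattice D"
  shows stoch_ge_trans: "\<mu> \<in> PS \<Longrightarrow> \<nu> \<in> PS \<Longrightarrow> \<rho> \<in> PS \<Longrightarrow>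
      stoch_ge D \<mu> \<nu> \<Longrightarrow> stoch_ge D \<nu> \<rho> \<Longrightarrow> stoch_ge D \<mu> \<rho>"
    and stoch_ge_antisym: "\<mu> \<in> PS \<Longrightarrow> \<nu> \<in> PS \<Longrightarrow>
      stoch_ge D \<mu> \<nu> \<Longrightarrow> stoch_ge D \<nu> \<mu> \<Longrightarrow> \<mu> = \<nu>"
    and stoch_ge_Sup_ex: "A \<subseteq> PS \<Longrightarrow> \<exists>s\<in>PS. (\<forall>\<mu>\<in>A. stoch_ge D s \<mu>) \<and>
      (\<forall>u\<in>PS. (\<forall>\<mu>\<in>A. stoch_ge D u \<mu>) \<longrightarrow> stoch_ge D u s)"
    and stoch_ge_Inf_ex: "A \<subseteq> PS \<Longrightarrow> \<exists>i\<in>PS. (\<forall>\<mu>\<in>A. stoch_ge D \<mu> i) \<and>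
      (\<forall>l\<in>PS. (\<forall>\<mu>\<in>A. stoch_ge D \<mu> l) \<longrightarrow> stoch_ge D i l)"
proof -
  note L = L[unfolded stoch_complete_lattice_def, THEN conjunct2]
  show "stoch_ge D \<mu> \<rho>"
    if "\<mu> \<in> PS" "\<nu> \<in> PS" "\<rho> \<in> PS" "stoch_ge D \<mu> \<nu>" "stoch_ge D \<nu> \<rho>"
    using L[THEN conjunct1] that by blast
  show "\<mu> = \<nu>" if "\<mu> \<in> PS" "\<nu> \<in> PS" "stoch_ge D \<mu> \<nu>" "stoch_ge D \<nu> \<mu>"
    using L[THEN conjunct2, THEN conjunct1] that by blast
  note SI = L[THEN conjunct2, THEN conjunct2]
  show "A \<subseteq> PS \<Longrightarrow> \<exists>s\<in>PS. (\<forall>\<mu>\<in>A. stoch_ge D s \<mu>) \<and>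
      (\<forall>u\<in>PS. (\<forall>\<mu>\<in>A. stoch_ge D u \<mu>) \<longrightarrow> stoch_ge D u s)"
    by (rule SI[THEN conjunct1, rule_format])
  show "A \<subseteq> PS \<Longrightarrow> \<exists>i\<in>PS. (\<forall>\<mu>\<in>A. stoch_ge D \<mu> i) \<and>
      (\<forall>l\<in>PS. (\<forall>\<mu>\<in>A. stoch_ge D \<mu> l) \<longrightarrow> stoch_ge D i l)"
    by (rule SI[THEN conjunct2, rule_format])
qed

text \<open>The infimum and the supremum of all laws are a least and a greatest law. The least one
  bounds \<open>f\<close> below; the greatest one, after negation, bounds \<open>f\<close>
  above.\<close>

lemma stoch_complete_lattice_bounded:
  fixes f :: "'a::polish_space \<Rightarrow> real"
  assumes L: "stoch_complete_lattice D" and f: "f \<in> D" "f \<in> borel_measurable borel"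
  shows "bounded (range f)"
proof -
  note antisym = stoch_ge_antisym[OF L]
  obtain b where b: "b \<in> PS" "\<And>\<mu>. \<mu> \<in> PS \<Longrightarrow> stoch_ge D \<mu> b"
    using stoch_ge_Inf_ex[OF L order_refl] by blast
  obtain t where t: "t \<in> PS" "\<And>\<mu>. \<mu> \<in> PS \<Longrightarrow> stoch_ge D t \<mu>"
    using stoch_ge_Sup_ex[OF L order_refl] by blast
  obtain c where c: "\<And>x. c \<le> f x"
    using bdd_below_if_least[OF b _ f] antisym b by blast
  have "\<exists>d. \<forall>x. d \<le> - f x"
  proof (rule bdd_below_if_least[OF t(1)])
    show "(\<lambda>x. - f x) \<in> (\<lambda>f x. - f x) ` D" using f by blast
  qed (use t antisym f in \<open>auto simp: stoch_ge_uminus\<close>)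
  then obtain d where "\<And>x. d \<le> - f x" by blast
  with c show ?thesis
    by (intro boundedI[where B="\<bar>c\<bar> + \<bar>d\<bar>"]) (smt (verit) imageE real_norm_def)
qed

section \<open>Monotone kernels and the greatest fixed point, for condition (ii)\<close>

lemma stoch_ge_bind_mono:
  assumes K: "K \<in> borel \<rightarrow>\<^sub>M prob_algebra borel"
    and pres: "\<And>f. f \<in> D \<Longrightarrow> (\<lambda>x. \<integral>y. f y \<partial>K x) \<in> D"
    and "\<theta> \<in> PS" "\<theta>' \<in> PS" "stoch_ge D \<theta>' \<theta>"
  shows "stoch_ge D (\<theta>' \<bind> K) (\<theta> \<bind> K)"
  unfolding stoch_ge_def
proof (intro ballI impI, elim conjE)
  fix f assume f: "f \<in> D" "f \<in> borel_measurable borel"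
    and int: "integrable (\<theta> \<bind> K) f" "integrable (\<theta>' \<bind> K) f"
  have "(\<integral>x. \<integral>y. f y \<partial>K x \<partial>\<theta>) \<le> (\<integral>x. \<integral>y. f y \<partial>K x \<partial>\<theta>')"
    using assms(3-5) f pres[OF f(1)] measurable_integral_kernel[OF K f(2)]
      integrable_integral_kernel[OF assms(3) K f(2) int(1)] integrable_integral_kernel[OF assms(4) K f(2) int(2)]
    unfolding stoch_ge_def by blast
  then show "integral\<^sup>L (\<theta> \<bind> K) f \<le> integral\<^sup>L (\<theta>' \<bind> K) f"
    using assms(3,4) K f int by (simp add: integral_bind_kernel)
qed

text \<open>A bounded measurable \<open>f\<close> is integrable against every \<open>K1 x\<close>
  and \<open>K2 x\<close>, so \<open>decr\<close> can be applied to it at each point and then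
  integrated over \<open>\<theta>\<close>.\<close>

lemma stoch_ge_bind_kernels:
  assumes bdd: "\<And>f. f \<in> D \<Longrightarrow> f \<in> borel_measurable borel \<Longrightarrow> bounded (range f)"
    and K1: "K1 \<in> borel \<rightarrow>\<^sub>M prob_algebra borel" and K2: "K2 \<in> borel \<rightarrow>\<^sub>M prob_algebra borel"
    and decr: "\<And>x. stoch_ge D (K1 x) (K2 x)" and \<theta>: "\<theta> \<in> PS"
  shows "stoch_ge D (\<theta> \<bind> K1) (\<theta> \<bind> K2)"
  unfolding stoch_ge_def
proof (intro ballI impI, elim conjE)
  fix f assume f: "f \<in> D" "f \<in> borel_measurable borel"
    and int: "integrable (\<theta> \<bind> K2) f" "integrable (\<theta> \<bind> K1) f"
  have "(\<integral>x. \<integral>y. f y \<partial>K2 x \<partial>\<theta>) \<le> (\<integral>x. \<integral>y. f y \<partial>K1 x \<partial>\<theta>)"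
  proof (intro integral_mono integrable_integral_kernel[OF \<theta> _ f(2)] K1 K2 int)
    fix x
    have "integrable (K1 x) f" "integrable (K2 x) f"
      using bdd[OF f] f by (auto intro!: integrable_bounded_PS kernel_PS K1 K2)
    then show "(\<integral>y. f y \<partial>K2 x) \<le> (\<integral>y. f y \<partial>K1 x)"
      using decr[of x] f unfolding stoch_ge_def by blast
  qed
  then show "integral\<^sup>L (\<theta> \<bind> K2) f \<le> integral\<^sup>L (\<theta> \<bind> K1) f"
    using K1 K2 \<theta> f int by (simp add: integral_bind_kernel)
qed

text \<open>Knaster-Tarski: the supremum of the laws that \<open>K1\<close> moves upwards is a fixed
  point of \<open>K1\<close>, hence \<open>\<mu>1\<close>. Since \<open>\<mu>2\<close> is invariant
  under the smaller kernel \<open>K2\<close>, it is moved upwards by \<open>K1\<close> and so lies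
  below this supremum.\<close>

lemma stoch_ge_fixed_points_lattice:
  fixes D :: "('a::polish_space \<Rightarrow> real) set"
  assumes K1: "K1 \<in> borel \<rightarrow>\<^sub>M prob_algebra borel" and K2: "K2 \<in> borel \<rightarrow>\<^sub>M prob_algebra borel"
    and pres: "\<And>f. f \<in> D \<Longrightarrow> (\<lambda>x. \<integral>y. f y \<partial>K1 x) \<in> D"
    and decr: "\<And>x. stoch_ge D (K1 x) (K2 x)"
    and unique: "\<And>\<theta>. \<theta> \<in> PS \<Longrightarrow> \<theta> \<bind> K1 = \<theta> \<Longrightarrow> \<theta> = \<mu>1"
    and \<mu>2: "\<mu>2 \<in> PS" "\<mu>2 \<bind> K2 = \<mu>2"
    and L: "stoch_complete_lattice D"
  shows "stoch_ge D \<mu>1 \<mu>2"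
proof -
  note bdd = stoch_complete_lattice_bounded[OF L]
  note antisym = stoch_ge_antisym[OF L]
  note trans = stoch_ge_trans[OF L]
  have mono: "stoch_ge D (\<theta>' \<bind> K1) (\<theta> \<bind> K1)" if "\<theta> \<in> PS" "\<theta>' \<in> PS" "stoch_ge D \<theta>' \<theta>" for \<theta> \<theta>'
    by (rule stoch_ge_bind_mono[OF K1 pres that])
  have K1_PS: "\<theta> \<bind> K1 \<in> PS" if "\<theta> \<in> PS" for \<theta>
    by (rule bind_PS[OF that K1])
  define A where "A = {\<theta> \<in> PS. stoch_ge D (\<theta> \<bind> K1) \<theta>}"
  have "A \<subseteq> PS" by (auto simp: A_def)
  from stoch_ge_Sup_ex[OF L this] obtain s where s: "s \<in> PS" "\<And>\<mu>. \<mu> \<in> A \<Longrightarrow> stoch_ge D s \<mu>"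
    "\<And>u. u \<in> PS \<Longrightarrow> (\<And>\<mu>. \<mu> \<in> A \<Longrightarrow> stoch_ge D u \<mu>) \<Longrightarrow> stoch_ge D u s" by blast
  have up: "stoch_ge D (s \<bind> K1) s"
  \<comment> \<open>The law \<open>s \<bind> K1\<close> is an upper bound of \<open>A\<close>: each
    \<open>\<theta>\<close> in \<open>A\<close> lies below \<open>\<theta> \<bind> K1\<close>, which
    by monotonicity lies below \<open>s \<bind> K1\<close>.\<close>
  proof (rule s(3)[OF K1_PS[OF s(1)]])
    fix \<theta> assume "\<theta> \<in> A"
    then have "\<theta> \<in> PS" "stoch_ge D (\<theta> \<bind> K1) \<theta>" "stoch_ge D s \<theta>" using s(2) by (auto simp: A_def)
    then show "stoch_ge D (s \<bind> K1) \<theta>"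
      using trans[OF K1_PS[OF s(1)] K1_PS] mono s(1) by blast
  qed
  then have "s \<bind> K1 \<in> A"
    using mono[OF s(1) K1_PS[OF s(1)]] by (simp add: A_def K1_PS s)
  then have "s \<bind> K1 = s"
    using up s(2) antisym K1_PS s(1) by blast
  then have "s = \<mu>1" by (rule unique[OF s(1)])
  moreover have "stoch_ge D (\<mu>2 \<bind> K1) (\<mu>2 \<bind> K2)"
    by (rule stoch_ge_bind_kernels[OF bdd K1 K2 decr \<mu>2(1)])
  then have "\<mu>2 \<in> A"
    unfolding A_def \<mu>2(2) using \<mu>2(1) by simp
  ultimately show ?thesis using s(2) by blast
qed

section \<open>Markov kernels from the given data, and uniqueness of the invariant law\<close>

text \<open>The set function defining \<open>Mh\<close> agrees on Borel sets with the measure of the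
  composition, and \<open>measure_of\<close> depends only on these values.\<close>

lemma Mh_eq_bind:
  fixes \<theta> :: "'a::topological_space measure"
  assumes \<theta>: "\<theta> \<in> PS" and K: "(\<lambda>x. Qk w \<phi> x h) \<in> borel \<rightarrow>\<^sub>M prob_algebra borel"
  shows "Mh w \<phi> h \<theta> = \<theta> \<bind> (\<lambda>x. Qk w \<phi> x h)"
proof -
  let ?B = "\<theta> \<bind> (\<lambda>x. Qk w \<phi> x h)"
  have K': "(\<lambda>x. Qk w \<phi> x h) \<in> \<theta> \<rightarrow>\<^sub>M subprob_algebra borel"
    using measurable_prob_algebraD[OF K] by (simp add: measurable_on_PS[OF \<theta>])
  have sets: "sets ?B = sets borel"
    using bind_PS[OF \<theta> K] by (simp add: PS_iff)
  have "Mh w \<phi> h \<theta> = measure_of UNIV (sets borel) (emeasure ?B)"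
    unfolding Mh_def
  proof (rule measure_of_eq)
    fix X :: "'a set" assume "X \<in> sigma_sets UNIV (sets borel)"
    then have "X \<in> sets borel"
      using sets.sigma_sets_eq[of "borel :: 'a measure"] by simp
    then show "(\<integral>\<^sup>+x. emeasure (Qk w \<phi> x h) X \<partial>\<theta>) = emeasure ?B X"
      using emeasure_bind[OF space_PS_ne[OF \<theta>] K'] by simp
  qed simp
  also have "\<dots> = ?B"
    using measure_of_of_measure[of ?B] sets sets_eq_imp_space_eq[OF sets] by simp
  finally show ?thesis .
qed

text \<open>For fixed \<open>h\<close> in \<open>A\<close> the section sending \<open>(x, e)\<close>
  to \<open>(x, h, e)\<close> maps measurably into the restricted product on which \<open>w\<close>
  is measurable. Pushing \<open>\<phi>\<close> forward then depends measurably on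
  \<open>x\<close>.\<close>

lemma Qk_kernel:
  fixes w :: "'a::polish_space \<Rightarrow> real \<Rightarrow> 'e::polish_space \<Rightarrow> 'a"
  assumes "prob_space \<phi>" and sets: "sets \<phi> = sets borel" and h: "h \<in> A"
    and w: "(\<lambda>(x, h, e). w x h e) \<in>
        restrict_space (borel \<Otimes>\<^sub>M borel \<Otimes>\<^sub>M borel) (UNIV \<times> A \<times> UNIV) \<rightarrow>\<^sub>M borel"
  shows "(\<lambda>x. Qk w \<phi> x h) \<in> borel \<rightarrow>\<^sub>M prob_algebra borel"
  unfolding Qk_def
proof (rule measurable_distr_prob_space2)
  show "(\<lambda>x. \<phi>) \<in> borel \<rightarrow>\<^sub>M prob_algebra borel"
    using assms by (simp add: space_prob_algebra)
  have "(\<lambda>(x, e). (x, h, e)) \<in> borel \<Otimes>\<^sub>M borel \<rightarrow>\<^sub>M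
      restrict_space (borel \<Otimes>\<^sub>M borel \<Otimes>\<^sub>M borel) (UNIV \<times> A \<times> UNIV)"
    using h by (intro measurable_restrict_space2) auto
  from measurable_compose[OF this w]
  show "(\<lambda>(x, e). w x h e) \<in> borel \<Otimes>\<^sub>M borel \<rightarrow>\<^sub>M borel"
    by (simp add: case_prod_unfold)
qed

theorem theorem1:
  fixes ge :: "'a::polish_space \<Rightarrow> 'a \<Rightarrow> bool"
    and H :: "'a measure \<Rightarrow> real"
    and \<phi> :: "'e::polish_space measure"
    and w :: "'a \<Rightarrow> real \<Rightarrow> 'e \<Rightarrow> 'a"
    and D :: "('a \<Rightarrow> real) set"
  assumes ge_refl: "\<And>x. ge x x"
    and ge_trans: "\<And>x y z. ge x y \<Longrightarrow> ge y z \<Longrightarrow> ge x z"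
    and ge_antisym: "\<And>x y. ge x y \<Longrightarrow> ge y x \<Longrightarrow> x = y"
    and ge_closed: "closed {(x, y). ge x y}"
    and H_meas: "H \<in> measurable (prob_algebra borel) borel"
    and phi_prob: "prob_space \<phi>" and phi_sets: "sets \<phi> = sets borel"
    and w_meas: "(\<lambda>(x, h, e). w x h e) \<in>
        measurable (restrict_space (borel \<Otimes>\<^sub>M borel \<Otimes>\<^sub>M borel) (UNIV \<times> H ` PS \<times> UNIV)) borel"
    and D_ne: "D \<noteq> {}"
    and H_inc: "H_increasing D H"
    and Q_pres: "D_preserving D H w \<phi>"
    and Q_decr: "D_decreasing D H w \<phi>"
    and cond: "(propC H w \<phi> TYPE('a) \<and> stoch_closed D) \<or>
               (propU H w \<phi> TYPE('a) \<and> stoch_complete_lattice D)"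
  shows "\<forall>\<mu>1\<in>PS. \<forall>\<mu>2\<in>PS. Top H w \<phi> \<mu>1 = \<mu>1 \<and> Top H w \<phi> \<mu>2 = \<mu>2 \<longrightarrow> \<mu>1 = \<mu>2"
proof -
  define K where "K h = (\<lambda>x. Qk w \<phi> x h)" for h
  have K: "K h \<in> borel \<rightarrow>\<^sub>M prob_algebra borel" if "h \<in> H ` PS" for h
    unfolding K_def by (rule Qk_kernel[OF phi_prob phi_sets that w_meas])
  have Mh: "Mh w \<phi> h \<theta> = \<theta> \<bind> K h" if "h \<in> H ` PS" "\<theta> \<in> PS" for h \<theta>
    using Mh_eq_bind[OF that(2)] K[OF that(1)] by (simp add: K_def)
  have iter: "(Mh w \<phi> h ^^ n) \<theta> = ((\<lambda>\<theta>. \<theta> \<bind> K h) ^^ n) \<theta>" if "h \<in> H ` PS" "\<theta> \<in> PS" for h \<theta> n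
    by (induction n) (simp_all add: Mh that iterates_PS[OF K])
  have pres: "(\<lambda>x. \<integral>y. f y \<partial>K h x) \<in> D" if "h \<in> H ` PS" "f \<in> D" for h f
    using Q_pres that unfolding D_preserving_def K_def by blast
  have U: "\<mu> = \<nu>" if "h \<in> H ` PS" "\<mu> \<in> PS" "\<nu> \<in> PS" "\<mu> \<bind> K h = \<mu>" "\<nu> \<bind> K h = \<nu>" for h \<mu> \<nu>
  proof -
    have "propU H w \<phi> TYPE('a)"
      using cond unfolding propC_def by blast
    then have "\<exists>!\<mu>. \<mu> \<in> PS \<and> Mh w \<phi> h \<mu> = \<mu>"
      using that(1) unfolding propU_def by (rule bspec)
    moreover have "Mh w \<phi> h \<mu> = \<mu>" "Mh w \<phi> h \<nu> = \<nu>"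
      using that by (simp_all add: Mh[OF that(1)])
    ultimately show ?thesis
      using that(2,3) by blast
  qed
  \<comment> \<open>\<open>Top\<close> at \<open>\<mu>\<close> is the linear operator with the
    aggregate frozen at \<open>H \<mu>\<close>.\<close>
  have fixed: "\<mu> \<bind> K (H \<mu>) = \<mu>" if "\<mu> \<in> PS" "Top H w \<phi> \<mu> = \<mu>" for \<mu>
    using Mh[of "H \<mu>" \<mu>] that by (simp add: Top_def Mh_def)
  have eq: "\<mu>1 = \<mu>2"
    if \<mu>: "\<mu>1 \<in> PS" "\<mu>2 \<in> PS" and fix1: "\<mu>1 \<bind> K (H \<mu>1) = \<mu>1" and fix2: "\<mu>2 \<bind> K (H \<mu>2) = \<mu>2"
      and le: "H \<mu>1 \<le> H \<mu>2" for \<mu>1 \<mu>2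
  proof -
    have h: "H \<mu>1 \<in> H ` PS" "H \<mu>2 \<in> H ` PS" using \<mu> by auto
    have decr: "stoch_ge D (K (H \<mu>1) x) (K (H \<mu>2) x)" for x
      using Q_decr h le unfolding D_decreasing_def K_def by blast
    from cond have "stoch_ge D \<mu>1 \<mu>2"
    proof (elim disjE conjE)
      assume C: "propC H w \<phi> TYPE('a)" and closed: "stoch_closed D"
      have "weak_conv (\<lambda>n. (Mh w \<phi> (H \<mu>2) ^^ n) \<mu>1) \<mu>2"
        using C[unfolded propC_def, THEN conjunct2, THEN bspec, OF h(2), THEN bspec, OF \<mu>(2)]
          Mh[OF h(2) \<mu>(2)] \<mu>(1) fix2 by simp
      then have lim: "weak_conv (\<lambda>n. ((\<lambda>\<theta>. \<theta> \<bind> K (H \<mu>2)) ^^ n) \<mu>1) \<mu>2"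
        by (simp add: iter h \<mu>)
      show ?thesis
        by (rule stoch_ge_limit_iterates[OF K[OF h(1)] K[OF h(2)] pres[OF h(2)] decr \<mu>(1) fix1 \<mu>(2) lim closed])
    next
      assume L: "stoch_complete_lattice D"
      have unique: "\<theta> = \<mu>1" if "\<theta> \<in> PS" "\<theta> \<bind> K (H \<mu>1) = \<theta>" for \<theta>
        using U[OF h(1) that(1) \<mu>(1) that(2) fix1] .
      show ?thesis
        by (rule stoch_ge_fixed_points_lattice[OF K[OF h(1)] K[OF h(2)] pres[OF h(1)] decr unique \<mu>(2) fix2 L])
    qed
    then have "H \<mu>2 \<le> H \<mu>1"
      using H_inc \<mu> by (simp add: H_increasing_def)
    \<comment> \<open>The two aggregates now coincide, so both laws are fixed by the same linear
      kernel.\<close>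
    with le fix2 have "\<mu>2 \<bind> K (H \<mu>1) = \<mu>2" by simp
    with U h(1) \<mu> fix1 show ?thesis by blast
  qed
  show ?thesis
  proof (intro ballI impI, elim conjE)
    fix \<mu>1 \<mu>2
    assume "\<mu>1 \<in> PS" "\<mu>2 \<in> PS" "Top H w \<phi> \<mu>1 = \<mu>1" "Top H w \<phi> \<mu>2 = \<mu>2"
    then show "\<mu>1 = \<mu>2"
      using eq[of \<mu>1 \<mu>2] eq[of \<mu>2 \<mu>1] fixed by (cases "H \<mu>1 \<le> H \<mu>2") auto
  qed
qed

end
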